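(* Let $\Gamma=(V,E)$ be a finite vertex-transitive graph (possibly disconnected), and $2\leq n\leq |V|-1$. Let $G$ be a group acting on $\Gamma$ by graph automorphisms, transitively on $V$, and assume that no action of $G$ on an $n$-point set is transitive. Then $h_{n+1}(\Gamma)\leq 2(n+1)h_n(\Gamma)$ and $\iota_{n+1}(\Gamma)\leq 2(n+1)\iota_n(\Gamma)$.
   Context: All graphs are finite, undirected, regular, without multiple edges or self-loops. $\partial A$ is the set of edges with exactly one endpoint in $A\subseteq V$; $\delta A$ is the set of vertices of $A$ having a neighbor outside $A$ together with the vertices outside $A$ having a neighbor in $A$. For $2\le n\le|V|$, $h_n(\Gamma)=\min\max_{1\le i\le n}|\partial A_i|/|A_i|$ and $\iota_n(\Gamma)=\min\max_{1\le i\le n}|\delta A_i|/|A_i|$, minima over all partitions of $V$ into $n$ non-empty disjoint subsets $A_1,\dots,A_n$. *)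

theory Defs
  imports Complex_Main "HOL-Library.Disjoint_Sets" "HOL-Algebra.Group_Action"
begin

text \<open>Edges are two-element sets of vertices, so loops and multiple edges are excluded.\<close>

locale finite_regular_graph =
  fixes V :: "'v set" and E :: "'v set set"
  assumes finite_vertices: "finite V"
    and edges: "E \<subseteq> {e. e \<subseteq> V \<and> card e = 2}"
    and regular: "\<exists>d. \<forall>v\<in>V. card {w \<in> V. {v, w} \<in> E} = d"

definition graph_automorphism :: "'v set \<Rightarrow> 'v set set \<Rightarrow> ('v \<Rightarrow> 'v) \<Rightarrow> bool" where
  "graph_automorphism V E f \<longleftrightarrow>
     bij_betw f V V \<and> (\<forall>u\<in>V. \<forall>v\<in>V. {f u, f v} \<in> E \<longleftrightarrow> {u, v} \<in> E)"

definition vertex_transitive :: "'v set \<Rightarrow> 'v set set \<Rightarrow> bool" where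
  "vertex_transitive V E \<longleftrightarrow> (\<forall>u\<in>V. \<forall>v\<in>V. \<exists>f. graph_automorphism V E f \<and> f u = v)"

definition edge_boundary :: "'v set set \<Rightarrow> 'v set \<Rightarrow> 'v set set" where
  "edge_boundary E A = {e \<in> E. card (e \<inter> A) = 1}"

definition vertex_boundary :: "'v set \<Rightarrow> 'v set set \<Rightarrow> 'v set \<Rightarrow> 'v set" where
  "vertex_boundary V E A =
     {v \<in> A. \<exists>w \<in> V - A. {v, w} \<in> E} \<union> {v \<in> V - A. \<exists>w \<in> A. {v, w} \<in> E}"

text \<open>The two n-way isoperimetric constants. For finite \<open>V\<close> and \<open>1 \<le> n \<le> card V\<close> the minima and
  maxima below range over finite non-empty sets; outside this range the values are meaningless.\<close>

definition h_const :: "'v set \<Rightarrow> 'v set set \<Rightarrow> nat \<Rightarrow> real" where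
  "h_const V E n =
     Min {Max ((\<lambda>A. real (card (edge_boundary E A)) / real (card A)) ` P) | P.
            partition_on V P \<and> card P = n}"

definition iota_const :: "'v set \<Rightarrow> 'v set set \<Rightarrow> nat \<Rightarrow> real" where
  "iota_const V E n =
     Min {Max ((\<lambda>A. real (card (vertex_boundary V E A)) / real (card A)) ` P) | P.
            partition_on V P \<and> card P = n}"

text \<open>It suffices to consider \<open>n\<close>-point sets of natural numbers, because every action on a finite
  set (of any type) can be transported to such a set; see the lemma below.\<close>

definition has_transitive_action_on_points :: "('g, 'm) monoid_scheme \<Rightarrow> nat \<Rightarrow> bool" where
  "has_transitive_action_on_points G n \<longleftrightarrow>
     (\<exists>(X :: nat set) \<psi>. finite X \<and> card X = n \<and> transitive_action G X \<psi>)"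

lemma has_transitive_action_on_pointsI:
  fixes X :: "'x set"
  assumes fin: "finite X" and n: "card X = n" and act: "transitive_action G X \<phi>"
  shows "has_transitive_action_on_points G n"
proof -
  interpret transitive_action G X \<phi> by (rule act)
  interpret hom: group_hom G "BijGroup X" \<phi> by (rule group_hom)
  obtain b :: "'x \<Rightarrow> nat" where b: "bij_betw b X {..<n}"
    using ex_bij_betw_finite_nat[OF fin] n by (auto simp: atLeast0LessThan)
  let ?Y = "{..<n}"
  define c where "c = inv_into X b"
  have c: "bij_betw c ?Y X" unfolding c_def by (rule bij_betw_inv_into[OF b])
  have cb: "c (b x) = x" if "x \<in> X" for x
    using b that by (simp add: c_def bij_betw_inv_into_left)
  have cX: "c y \<in> X" if "y \<in> ?Y" for y using c that by (rule bij_betw_apply)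
  have bY: "b x \<in> ?Y" if "x \<in> X" for x using b that by (rule bij_betw_apply)
  define \<psi> where "\<psi> g = restrict (\<lambda>y. b (\<phi> g (c y))) ?Y" for g
  have bij: "\<psi> g \<in> Bij ?Y" if "g \<in> carrier G" for g
  proof -
    have "bij_betw (\<phi> g) X X" using bij_prop0[OF that] by (simp add: Bij_def)
    then have "bij_betw (b \<circ> (\<phi> g \<circ> c)) ?Y ?Y"
      using b c by (blast intro: bij_betw_trans)
    then have "bij_betw (\<psi> g) ?Y ?Y"
      by (rule bij_betw_cong[THEN iffD1, rotated]) (simp add: \<psi>_def)
    then show ?thesis by (simp add: Bij_def \<psi>_def)
  qed
  have mult: "\<psi> (g \<otimes>\<^bsub>G\<^esub> h) = compose ?Y (\<psi> g) (\<psi> h)"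
    if "g \<in> carrier G" "h \<in> carrier G" for g h
  proof
    fix y
    show "\<psi> (g \<otimes>\<^bsub>G\<^esub> h) y = compose ?Y (\<psi> g) (\<psi> h) y"
    proof (cases "y \<in> ?Y")
      case True
      then have "\<phi> h (c y) \<in> X" using that cX element_image by blast
      then show ?thesis
        using True that cX[OF True] bY cb composition_rule[OF cX[OF True] that]
        by (simp add: \<psi>_def compose_def)
    qed (simp add: \<psi>_def compose_def)
  qed
  have "group_hom G (BijGroup ?Y) \<psi>"
    using group_BijGroup[of ?Y] hom.is_group bij mult
    by (auto simp: group_hom_def group_hom_axioms_def hom_def BijGroup_def)
  moreover have "\<exists>g\<in>carrier G. \<psi> g x = y" if xy: "x \<in> ?Y" "y \<in> ?Y" for x y
  proof -
    obtain g where "g \<in> carrier G" "\<phi> g (c x) = c y"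
      using unique_orbit[OF cX[OF xy(1)] cX[OF xy(2)]] by blast
    moreover have "b (c y) = y" using b xy(2) by (simp add: c_def bij_betw_inv_into_right)
    ultimately show ?thesis using xy(1) by (auto simp: \<psi>_def intro!: bexI[of _ g])
  qed
  ultimately have "transitive_action G ?Y \<psi>"
    by (simp add: transitive_action_def group_action_def transitive_action_axioms_def)
  then show ?thesis
    unfolding has_transitive_action_on_points_def by (intro exI[of _ ?Y] exI[of _ \<psi>]) simp
qed

end

theory Submission
  imports Defs
begin

text \<open>Let \<open>P\<close> be an optimal partition into \<open>n\<close> parts, with constant \<open>h\<close>, and let \<open>A\<close> be a smallest part.
  For \<open>g \<in> G\<close> the sets \<open>gA\<close> and \<open>B - gA\<close> with \<open>B \<in> P\<close> have boundaries of size at most \<open>2 h |B|\<close>.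
  If \<open>|B \<inter> gA| \<le> n/(n+1) |B|\<close> for all \<open>B \<in> P\<close>, then \<open>|B| \<le> (n+1) |B - gA|\<close>, so these are \<open>n + 1\<close>
  parts witnessing the bound \<open>2 (n+1) h\<close>. Otherwise every translate \<open>gA\<close> almost contains some part
  \<open>j g \<in> P\<close>, which is unique by counting. Averaging over \<open>G\<close> shows that \<open>j\<close> is onto \<open>P\<close>, and
  \<open>j g = j h\<close> depends only on \<open>|gA \<inter> hA|\<close>, which is invariant under left translation. Hence
  \<open>k \<cdot> j g = j (k g)\<close> is a transitive action of \<open>G\<close> on the \<open>n\<close>-point set \<open>P\<close>.\<close>

section \<open>Quotients of the left regular action\<close>

text \<open>By \<open>cong\<close>, left translation respects the fibres of \<open>j\<close>, so
  left multiplication descends along \<open>j\<close> to \<open>X\<close>. Transitivity is inherited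
  from that of \<open>G\<close> acting on itself.\<close>

lemma has_transitive_action_on_points_imageI:
  fixes G :: "('g, 'm) monoid_scheme" (structure) and j :: "'g \<Rightarrow> 'x"
  assumes "group G" and fin: "finite X" and n: "card X = n"
    and onto: "j ` carrier G = X"
    and cong: "\<And>k g h. \<lbrakk>k \<in> carrier G; g \<in> carrier G; h \<in> carrier G; j g = j h\<rbrakk>
                 \<Longrightarrow> j (k \<otimes> g) = j (k \<otimes> h)"
  shows "has_transitive_action_on_points G n"
proof -
  interpret group G by fact
  define s where "s x = (SOME g. g \<in> carrier G \<and> j g = x)" for x
  have s: "s x \<in> carrier G" "j (s x) = x" if "x \<in> X" for x
    using someI_ex[of "\<lambda>g. g \<in> carrier G \<and> j g = x"] that onto by (auto simp: s_def)
  \<comment> \<open>The preimage \<open>s x\<close> is arbitrary; \<open>cong\<close> makes the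
    value independent of it, as \<open>\<psi>_j\<close> records. The restriction to \<open>X\<close>
    makes \<open>\<psi> k\<close> extensional, as \<open>Bij X\<close> demands.\<close>
  define \<psi> where "\<psi> k = (\<lambda>x\<in>X. j (k \<otimes> s x))" for k
  have jX: "j g \<in> X" if "g \<in> carrier G" for g using that onto by blast
  have \<psi>_j: "\<psi> k (j g) = j (k \<otimes> g)" if "k \<in> carrier G" "g \<in> carrier G" for k g
    using that jX s by (auto simp: \<psi>_def intro!: cong)
  have elem: "\<exists>g\<in>carrier G. x = j g" if "x \<in> X" for x using that onto by blast
  have \<psi>_X: "\<psi> k x \<in> X" if "k \<in> carrier G" "x \<in> X" for k x
    using that jX s by (auto simp: \<psi>_def)
  have comp: "\<psi> (k \<otimes> l) x = \<psi> k (\<psi> l x)"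
    if "k \<in> carrier G" "l \<in> carrier G" "x \<in> X" for k l x
    using elem[OF that(3)] that by (auto simp: \<psi>_j m_assoc)
  have one: "\<psi> \<one> x = x" if "x \<in> X" for x
    using elem[OF that] by (auto simp: \<psi>_j)
  have bij: "\<psi> k \<in> Bij X" if "k \<in> carrier G" for k
  proof -
    have "bij_betw (\<psi> k) X X"
      using that by (intro bij_betwI[where g = "\<psi> (inv k)"]) (auto simp: \<psi>_X one simp flip: comp)
    then show ?thesis by (simp add: Bij_def \<psi>_def)
  qed
  have "\<psi> (k \<otimes> l) = compose X (\<psi> k) (\<psi> l)" if "k \<in> carrier G" "l \<in> carrier G" for k l
  proof
    fix x show "\<psi> (k \<otimes> l) x = compose X (\<psi> k) (\<psi> l) x"
      by (cases "x \<in> X") (use that comp in \<open>auto simp: compose_def \<psi>_def\<close>)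
  qed
  then have "group_hom G (BijGroup X) \<psi>"
    using group_BijGroup[of X] is_group bij
    by (auto simp: group_hom_def group_hom_axioms_def hom_def BijGroup_def)
  moreover have "\<exists>k\<in>carrier G. \<psi> k x = y" if xy: "x \<in> X" "y \<in> X" for x y
  proof -
    obtain g where g: "g \<in> carrier G" "x = j g" using elem[OF xy(1)] by blast
    obtain h where h: "h \<in> carrier G" "y = j h" using elem[OF xy(2)] by blast
    from g h have "\<psi> (h \<otimes> inv g) x = y" by (simp add: \<psi>_j m_assoc)
    then show ?thesis using g h by (intro bexI[of _ "h \<otimes> inv g"]) auto
  qed
  ultimately have "transitive_action G X \<psi>"
    by (simp add: transitive_action_def group_action_def transitive_action_axioms_def)
  then show ?thesis by (rule has_transitive_action_on_pointsI[OF fin n])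
qed

section \<open>Translates of sets and averaging over a transitive action\<close>

lemma (in group_action) image_mult:
  assumes "g \<in> carrier G" "h \<in> carrier G" "A \<subseteq> E"
  shows "\<phi> (g \<otimes> h) ` A = \<phi> g ` \<phi> h ` A"
  unfolding image_image using assms by (intro image_cong refl composition_rule) auto

lemma (in group_action) card_image_Int:
  assumes "g \<in> carrier G" "A \<subseteq> E" "B \<subseteq> E"
  shows "card (\<phi> g ` A \<inter> \<phi> g ` B) = card (A \<inter> B)"
proof -
  have "\<phi> g ` A \<inter> \<phi> g ` B = \<phi> g ` (A \<inter> B)"
    using assms by (simp add: inj_on_image_Int[OF inj_prop])
  moreover have "inj_on (\<phi> g) (A \<inter> B)" using assms by (meson inj_prop inj_on_subset le_infI1)
  ultimately show ?thesis by (simp add: card_image)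
qed

text \<open>Averaging over the image of \<open>G\<close> in the permutation group, since \<open>G\<close> itself may be infinite.\<close>

lemma (in transitive_action) exists_large_translate_Int:
  assumes fin: "finite E" and A: "A \<subseteq> E" and R: "R \<subseteq> E"
  shows "\<exists>g\<in>carrier G. card R * card A \<le> card E * card (R \<inter> \<phi> g ` A)"
proof (rule ccontr)
  assume "\<not> ?thesis"
  then have small: "card E * card (R \<inter> \<phi> g ` A) < card R * card A" if "g \<in> carrier G" for g
    using that by (force simp: not_le)
  interpret group G using group_hom by (rule group_hom.axioms(1))
  define F where "F = \<phi> ` carrier G"
  have finF: "finite F"
  proof (rule finite_subset)
    show "F \<subseteq> (\<Pi>\<^sub>E x\<in>E. E)"
      using bij_prop0 by (auto simp: F_def PiE_def Bij_def dest: bij_betwE)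
    show "finite (\<Pi>\<^sub>E x\<in>E. E)" using fin by (intro finite_PiE) auto
  qed
  have F0: "F \<noteq> {}" by (auto simp: F_def)
  define N where "N a r = card {f \<in> F. f a = r}" for a r
  \<comment> \<open>Composition with a group element taking \<open>r\<close> to \<open>r'\<close>
    embeds one fibre of evaluation at \<open>a\<close> in the other. Exchanging \<open>r\<close> and
    \<open>r'\<close> gives equality: every point is hit equally often.\<close>
  have N_le: "N a r \<le> N a r'" if ar: "a \<in> E" "r \<in> E" "r' \<in> E" for a r r'
  proof -
    obtain k where k: "k \<in> carrier G" "\<phi> k r = r'" using unique_orbit ar by blast
    have "inj_on (compose E (\<phi> k)) {f \<in> F. f a = r}"
    proof (rule inj_onI)
      fix f f' assume f: "f \<in> {f \<in> F. f a = r}" "f' \<in> {f \<in> F. f a = r}"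
        and eq: "compose E (\<phi> k) f = compose E (\<phi> k) f'"
      have ext: "f \<in> Bij E" "f' \<in> Bij E" using f bij_prop0 by (auto simp: F_def)
      show "f = f'"
      proof (rule extensionalityI[of _ E])
        fix x assume "x \<in> E"
        then have "\<phi> k (f x) = \<phi> k (f' x)" using fun_cong[OF eq, of x] by (simp add: compose_eq)
        moreover have "f x \<in> E" "f' x \<in> E" using ext[THEN Bij_imp_funcset] \<open>x \<in> E\<close> by blast+
        ultimately show "f x = f' x" by (rule inj_onD[OF inj_prop[OF k(1)]])
      qed (use ext in \<open>auto simp: Bij_def\<close>)
    qed
    moreover have "compose E (\<phi> k) ` {f \<in> F. f a = r} \<subseteq> {f \<in> F. f a = r'}"
    proof safe
      fix f assume "f \<in> F" "r = f a"
      then obtain g where g: "g \<in> carrier G" "f = \<phi> g" by (auto simp: F_def)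
      then have "compose E (\<phi> k) f = \<phi> (k \<otimes> g)"
        using k group_hom.hom_mult[OF group_hom, of k g] by (simp add: BijGroup_def bij_prop0)
      then show "compose E (\<phi> k) f \<in> F" using g k by (auto simp: F_def)
      show "compose E (\<phi> k) f a = r'" using ar k \<open>r = f a\<close> by (simp add: compose_def)
    qed
    ultimately show ?thesis unfolding N_def using finF by (intro card_inj_on_le[of "compose E (\<phi> k)"]) auto
  qed
  have fibres: "card {f \<in> F. f a \<in> S} = (\<Sum>r\<in>S. N a r)" if "S \<subseteq> E" for a S
  proof -
    have "{f \<in> F. f a \<in> S} = (\<Union>r\<in>S. {f \<in> F. f a = r})" by auto
    then show ?thesis unfolding N_def
      using finF finite_subset[OF that fin] by (simp add: card_UN_disjoint disjoint_iff)
  qed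
  have N: "card E * N a r = card F" if ar: "a \<in> E" "r \<in> E" for a r
  proof -
    have "{f \<in> F. f a \<in> E} = F" using ar element_image by (auto simp: F_def)
    then have "card F = (\<Sum>r'\<in>E. N a r')" using fibres[of E a] by simp
    also have "\<dots> = (\<Sum>r'\<in>E. N a r)" using N_le ar by (intro sum.cong) (auto intro: antisym)
    finally show ?thesis by simp
  qed
  have finA: "finite A" "finite R" using A R fin finite_subset by auto
  have "(\<Sum>f\<in>F. card E * card (R \<inter> f ` A)) = card E * (\<Sum>f\<in>F. card {a \<in> A. f a \<in> R})"
    unfolding sum_distrib_left
  proof (rule sum.cong[OF refl])
    fix f assume "f \<in> F"
    then have "inj_on f A" using inj_prop A by (auto simp: F_def intro: inj_on_subset)
    then have "card (f ` {a \<in> A. f a \<in> R}) = card {a \<in> A. f a \<in> R}"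
      by (intro card_image) (auto intro: inj_on_subset)
    moreover have "f ` {a \<in> A. f a \<in> R} = R \<inter> f ` A" by auto
    ultimately show "card E * card (R \<inter> f ` A) = card E * card {a \<in> A. f a \<in> R}" by simp
  qed
  also have "(\<Sum>f\<in>F. card {a \<in> A. f a \<in> R}) = (\<Sum>a\<in>A. card {f \<in> F. f a \<in> R})"
    using sum.swap_restrict[OF finF finA(1), of "\<lambda>_ _. 1::nat" "\<lambda>f a. f a \<in> R"] by simp
  also have "card E * \<dots> = (\<Sum>a\<in>A. \<Sum>r\<in>R. card E * N a r)"
    using fibres[OF R] by (simp add: sum_distrib_left)
  also have "\<dots> = (\<Sum>a\<in>A. \<Sum>r\<in>R. card F)"
    using A R by (intro sum.cong refl N) auto
  also have "\<dots> = (\<Sum>f\<in>F. card R * card A)" by simp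
  finally have "(\<Sum>f\<in>F. card E * card (R \<inter> f ` A)) = (\<Sum>f\<in>F. card R * card A)" .
  moreover have "(\<Sum>f\<in>F. card E * card (R \<inter> f ` A)) < (\<Sum>f\<in>F. card R * card A)"
    by (rule sum_strict_mono[OF finF F0]) (auto simp: F_def small)
  ultimately show False by simp
qed

text \<open>Inclusion-exclusion without subtraction: sets that together exceed \<open>C\<close>
  overlap in at least the excess. For disjoint sets it bounds the sum of their sizes.\<close>

lemma card_add_le_Int:
  assumes "finite C" "A \<subseteq> C" "B \<subseteq> C"
  shows "card A + card B \<le> card C + card (A \<inter> B)"
proof -
  have "finite A" "finite B" using assms by (auto intro: finite_subset)
  then have "card A + card B = card (A \<union> B) + card (A \<inter> B)" by (rule card_Un_Int)
  moreover have "card (A \<union> B) \<le> card C" using assms by (intro card_mono) auto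
  ultimately show ?thesis by linarith
qed

section \<open>From an almost invariant partition to a transitive action\<close>

lemma (in transitive_action) has_transitive_action_of_almost_invariant_partition:
  assumes fin: "finite E" and n: "2 \<le> n" and P: "partition_on E P" "card P = n"
    and A: "A \<in> P" and smallest: "\<And>B. B \<in> P \<Longrightarrow> card A \<le> card B"
    and near: "\<And>g. g \<in> carrier G \<Longrightarrow> \<exists>B\<in>P. n * card B < (n + 1) * card (B \<inter> \<phi> g ` A)"
  shows "has_transitive_action_on_points G n"
proof -
  interpret group G using group_hom by (rule group_hom.axioms(1))
  define m where "m = card A"
  have sub: "B \<subseteq> E" if "B \<in> P" for B using P that by (auto simp: partition_on_def)
  have finB: "finite B" if "B \<in> P" for B using sub[OF that] fin finite_subset by blast
  have finP: "finite P" using P fin finite_elements by blast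
  have disj: "B \<inter> C = {}" if "B \<in> P" "C \<in> P" "B \<noteq> C" for B C
    using P that by (auto simp: partition_on_def disjoint_def)
  have m0: "m > 0" using P A finB by (auto simp: m_def partition_on_def card_gt_0_iff)
  have gE: "\<phi> g ` A \<subseteq> E" if "g \<in> carrier G" for g
    using sub[OF A] surj_prop[OF that] by blast
  have fing: "finite (\<phi> g ` A)" if "g \<in> carrier G" for g using finB[OF A] by blast
  have card_g: "card (\<phi> g ` A) = m" if "g \<in> carrier G" for g
    using card_image_Int[OF that sub[OF A] sub[OF A]] by (simp add: m_def)
  define j where "j g = (SOME B. B \<in> P \<and> n * card B < (n + 1) * card (B \<inter> \<phi> g ` A))" for g
  have j: "j g \<in> P" "n * card (j g) < (n + 1) * card (j g \<inter> \<phi> g ` A)" if "g \<in> carrier G" for g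
    using someI_ex[of "\<lambda>B. B \<in> P \<and> n * card B < (n + 1) * card (B \<inter> \<phi> g ` A)"] near[OF that]
    by (auto simp: j_def)
  \<comment> \<open>As \<open>m\<close> is the least size of a part, a share above
    \<open>n/(n+1)\<close> of \<open>j g\<close> is also a share above \<open>n/(n+1)\<close> of the
    translate.\<close>
  have jm: "n * m < (n + 1) * card (j g \<inter> \<phi> g ` A)" if "g \<in> carrier G" for g
    using j[OF that] smallest[of "j g"] mult_le_mono2[of m "card (j g)" n]
    unfolding m_def by linarith
  \<comment> \<open>A share above \<open>(n-1)/(n+1)\<close> of the translate already identifies the
    part: another part would hold a share above \<open>n/(n+1)\<close>, and the two add up to more
    than \<open>(2*n-1)/(n+1)\<close>, which is at least 1 for \<open>n \<ge> 2\<close>.\<close>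
  have j_eqI: "j g = B"
    if g: "g \<in> carrier G" and B: "B \<in> P" and large: "n * m < (n + 1) * card (B \<inter> \<phi> g ` A) + m"
    for g B
  proof (rule ccontr)
    assume "j g \<noteq> B"
    then have "(B \<inter> \<phi> g ` A) \<inter> (j g \<inter> \<phi> g ` A) = {}" using disj j g B by blast
    then have "card (B \<inter> \<phi> g ` A) + card (j g \<inter> \<phi> g ` A) \<le> m"
      using card_add_le_Int[of "\<phi> g ` A" "B \<inter> \<phi> g ` A" "j g \<inter> \<phi> g ` A"] fing[OF g] card_g[OF g]
      by simp
    from mult_le_mono2[OF this, of "n + 1"]
    have "(n + 1) * card (B \<inter> \<phi> g ` A) + (n + 1) * card (j g \<inter> \<phi> g ` A) \<le> n * m + m"
      by (simp add: algebra_simps)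
    with large jm[OF g] have "n * m < 2 * m" by linarith
    with n show False by simp
  qed
  \<comment> \<open>The threshold is that of \<open>j_eqI\<close>. The relation is visibly invariant
    under left translation, and it turns out to be equivalent to \<open>j g = j h\<close>.\<close>
  define overlap where
    "overlap g h \<longleftrightarrow> n * m < (n + 1) * card (\<phi> g ` A \<inter> \<phi> h ` A) + m" for g h
  have overlap_mult: "overlap (k \<otimes> g) (k \<otimes> h) \<longleftrightarrow> overlap g h"
    if "k \<in> carrier G" "g \<in> carrier G" "h \<in> carrier G" for k g h
    using that by (simp add: overlap_def image_mult[OF _ _ sub[OF A]] card_image_Int gE)
  have one: "\<phi> \<one> ` A = A" using sub[OF A] by (auto simp flip: id_eq_one simp: image_iff)
  \<comment> \<open>Two translates that each fill more than \<open>n/(n+1)\<close> of a part of size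
    \<open>b\<close> share more than \<open>(n-1)/(n+1) * b\<close> points, and
    \<open>b \<ge> m\<close>.\<close>
  have overlapI: "overlap g h" if g: "g \<in> carrier G" and h: "h \<in> carrier G" and eq: "j g = j h" for g h
  proof -
    define b where "b = card (j g)"
    define c where "c = card (\<phi> g ` A \<inter> \<phi> h ` A)"
    have "card (j g \<inter> \<phi> g ` A) + card (j g \<inter> \<phi> h ` A)
            \<le> b + card ((j g \<inter> \<phi> g ` A) \<inter> (j g \<inter> \<phi> h ` A))"
      unfolding b_def using j g finB by (intro card_add_le_Int) auto
    also have "card ((j g \<inter> \<phi> g ` A) \<inter> (j g \<inter> \<phi> h ` A)) \<le> c"
      unfolding c_def using fing g by (intro card_mono) auto
    finally have "(n + 1) * card (j g \<inter> \<phi> g ` A) + (n + 1) * card (j g \<inter> \<phi> h ` A) \<le> (n + 1) * (b + c)"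
      by (metis add_left_mono distrib_left mult_le_mono2)
    then have "2 * (n * b) < (n + 1) * (b + c)"
      using j(2)[OF g] j(2)[OF h] eq b_def by simp
    then have *: "n * b < b + (n + 1) * c" by (simp add: algebra_simps)
    obtain k where k: "n = Suc k" using n by (cases n) auto
    have "k * m \<le> k * b" using smallest j g by (simp add: m_def b_def)
    moreover have "k * b < (n + 1) * c" using * by (simp add: k)
    ultimately have "k * m < (n + 1) * c" by linarith
    then show ?thesis by (simp add: overlap_def k flip: c_def)
  qed
  \<comment> \<open>For \<open>n = 2\<close> the overlap is too weak for a direct comparison of \<open>j g\<close> and \<open>j h\<close>; moving it to
    \<open>\<one>\<close> and \<open>inv g \<otimes> h\<close> makes \<open>A\<close> itself the common part and improves the bound.\<close>
  have overlapD: "j g = j h" if g: "g \<in> carrier G" and h: "h \<in> carrier G" and "overlap g h" for g h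
  proof -
    have k: "inv g \<otimes> h \<in> carrier G" using g h by simp
    have gk: "g \<otimes> (inv g \<otimes> h) = h" using g h by (simp flip: m_assoc)
    then have "overlap \<one> (inv g \<otimes> h)"
      using overlap_mult[of g \<one> "inv g \<otimes> h"] that by simp
    then have "j (inv g \<otimes> h) = A" using j_eqI[OF k A] by (simp add: overlap_def one)
    then have "n * m < (n + 1) * card (A \<inter> \<phi> (inv g \<otimes> h) ` A)" using jm[OF k] by simp
    also have "card (A \<inter> \<phi> (inv g \<otimes> h) ` A) = card (\<phi> g ` A \<inter> \<phi> h ` A)"
      using card_image_Int[OF g sub[OF A] gE[OF k]] image_mult[OF g k sub[OF A]] gk by simp
    finally have strong: "n * m < (n + 1) * card (\<phi> g ` A \<inter> \<phi> h ` A)" .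
    \<comment> \<open>Inside the translate by \<open>g\<close>, both sets have a share above
      \<open>n/(n+1)\<close>, so they meet in a share above \<open>(n-1)/(n+1)\<close>. This puts
      enough of the translate by \<open>h\<close> into \<open>j g\<close> for
      \<open>j_eqI\<close>.\<close>
    have "card (\<phi> g ` A \<inter> \<phi> h ` A) + card (j g \<inter> \<phi> g ` A)
            \<le> m + card ((\<phi> g ` A \<inter> \<phi> h ` A) \<inter> (j g \<inter> \<phi> g ` A))"
      using card_add_le_Int[of "\<phi> g ` A" "\<phi> g ` A \<inter> \<phi> h ` A" "j g \<inter> \<phi> g ` A"] fing[OF g] card_g[OF g]
      by simp
    also have "card ((\<phi> g ` A \<inter> \<phi> h ` A) \<inter> (j g \<inter> \<phi> g ` A)) \<le> card (j g \<inter> \<phi> h ` A)"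
      using fing h by (intro card_mono) auto
    finally have "(n + 1) * card (\<phi> g ` A \<inter> \<phi> h ` A) + (n + 1) * card (j g \<inter> \<phi> g ` A)
        \<le> (n + 1) * (m + card (j g \<inter> \<phi> h ` A))"
      by (metis add_left_mono distrib_left mult_le_mono2)
    then have "n * m < (n + 1) * card (j g \<inter> \<phi> h ` A) + m"
      using strong jm[OF g] by (simp add: algebra_simps)
    then show ?thesis using j_eqI[OF h j(1)[OF g]] by simp
  qed
  have onto: "j ` carrier G = P"
  proof (rule ccontr)
    assume ne: "j ` carrier G \<noteq> P"
    define J where "J = j ` carrier G"
    have JP: "J \<subset> P" using ne j by (auto simp: J_def)
    \<comment> \<open>The region missed by \<open>j\<close> is bounded in two incompatible ways. By
      averaging, some translate has at least the share \<open>card R / card E\<close> in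
      \<open>R\<close>, while \<open>j g\<close> leaves it less than \<open>1/(n+1)\<close>; hence
      \<open>n * card R \<le> card (\<Union>J)\<close>. But \<open>J\<close> has at most
      \<open>n - 1\<close> parts, all small, and \<open>card R \<ge> m\<close>.\<close>
    define R where "R = \<Union>(P - J)"
    have RE: "R \<subseteq> E" using sub by (auto simp: R_def)
    obtain B where "B \<in> P" "B \<subseteq> R" using JP by (auto simp: R_def)
    then have mR: "m \<le> card R"
      using smallest[of B] card_mono[of R B] finite_subset[OF RE fin] by (force simp: m_def)
    have "E = \<Union>J \<union> R" "\<Union>J \<inter> R = {}"
      using P JP disj by (auto simp: R_def partition_on_def)
    then have cardE: "card E = card (\<Union>J) + card R" using fin by (simp add: card_Un_disjoint)
    \<comment> \<open>A part in the range of \<open>j\<close> is filled beyond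
      \<open>n/(n+1)\<close> by a set of only \<open>m\<close> points.\<close>
    have Jsmall: "n * card B \<le> (n + 1) * m" if B: "B \<in> J" for B
    proof -
      obtain g where g: "g \<in> carrier G" "B = j g" using B by (auto simp: J_def)
      have "card (B \<inter> \<phi> g ` A) \<le> m" using card_mono[OF fing[OF g(1)]] card_g[OF g(1)] by (metis Int_lower2)
      from mult_le_mono2[OF this, of "n + 1"] show ?thesis using j(2)[OF g(1)] g by simp
    qed
    have "n * card (\<Union>J) = (\<Sum>B\<in>J. n * card B)"
      using JP finB disj by (subst card_Union_disjoint) (auto simp: sum_distrib_left pairwise_def disjnt_def)
    also have "\<dots> \<le> card J * ((n + 1) * m)" 
      using sum_bounded_above[of J "\<lambda>B. n * card B", OF Jsmall] unfolding of_nat_id .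
    also have "\<dots> \<le> (n - 1) * ((n + 1) * m)"
      using psubset_card_mono[OF finP JP] P by (intro mult_le_mono1) simp
    finally have U: "n * card (\<Union>J) \<le> (n - 1) * ((n + 1) * m)" .
    obtain g where g: "g \<in> carrier G" "card R * m \<le> card E * card (R \<inter> \<phi> g ` A)"
      using exists_large_translate_Int[OF fin sub[OF A] RE] by (auto simp: m_def)
    have "(R \<inter> \<phi> g ` A) \<inter> (j g \<inter> \<phi> g ` A) = {}" using disj j g by (auto simp: R_def J_def)
    then have "card (R \<inter> \<phi> g ` A) + card (j g \<inter> \<phi> g ` A) \<le> m"
      using card_add_le_Int[of "\<phi> g ` A" "R \<inter> \<phi> g ` A" "j g \<inter> \<phi> g ` A"] fing g card_g by simp
    from mult_le_mono2[OF this, of "n + 1"] have "(n + 1) * card (R \<inter> \<phi> g ` A) \<le> m"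
      using jm[OF g(1)] by (simp add: algebra_simps)
    then have "card E * ((n + 1) * card (R \<inter> \<phi> g ` A)) \<le> card E * m" by (rule mult_le_mono2)
    moreover have "(n + 1) * (card R * m) \<le> (n + 1) * (card E * card (R \<inter> \<phi> g ` A))"
      using g(2) by (rule mult_le_mono2)
    ultimately have "((n + 1) * card R) * m \<le> card E * m" by (simp add: algebra_simps)
    then have "(n + 1) * card R \<le> card E" using m0 by simp
    then have "n * card R \<le> card (\<Union>J)" using cardE by simp
    from mult_le_mono2[OF this, of n] U
    have "n * (n * card R) \<le> (n - 1) * ((n + 1) * m)" by linarith
    moreover have "n * (n * m) \<le> n * (n * card R)" using mR by simp
    \<comment> \<open>The contradiction is \<open>n^2 * m \<le> (n^2 - 1) * m\<close> with
      \<open>m\<close> positive.\<close>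
    moreover have "(n - 1) * ((n + 1) * m) + m = n * (n * m)"
      using n by (cases n) (auto simp: algebra_simps)
    ultimately show False using m0 by linarith
  qed
  show ?thesis
  proof (rule has_transitive_action_on_points_imageI[OF is_group finP P(2) onto])
    fix k g h assume *: "k \<in> carrier G" "g \<in> carrier G" "h \<in> carrier G" "j g = j h"
    then have "overlap (k \<otimes> g) (k \<otimes> h)" by (simp add: overlap_mult overlapI)
    with * show "j (k \<otimes> g) = j (k \<otimes> h)" by (intro overlapD) auto
  qed
qed

section \<open>Isoperimetric constants for an arbitrary boundary size\<close>

text \<open>Abstracting the boundary size to \<open>b\<close> lets one argument serve both the edge
  and the vertex constant.\<close>

definition iso_const :: "'v set \<Rightarrow> ('v set \<Rightarrow> nat) \<Rightarrow> nat \<Rightarrow> real" where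
  "iso_const V b n =
     Min {Max ((\<lambda>A. real (b A) / real (card A)) ` P) | P. partition_on V P \<and> card P = n}"

lemma iso_const_finite:
  assumes "finite V"
  shows "finite {Max ((\<lambda>A. real (b A) / real (card A)) ` P) | P. partition_on V P \<and> card P = n}"
  using finitely_many_partition_on[OF assms] by simp

text \<open>A single partition bounds the minimum from above. Positivity of \<open>n\<close> keeps
  the inner \<open>Max\<close> off the empty set.\<close>

lemma iso_const_le:
  assumes V: "finite V" and P: "partition_on V P" "card P = n" "0 < n"
    and le: "\<And>A. A \<in> P \<Longrightarrow> real (b A) \<le> c * real (card A)"
  shows "iso_const V b n \<le> c"
proof -
  have "iso_const V b n \<le> Max ((\<lambda>A. real (b A) / real (card A)) ` P)"
    unfolding iso_const_def using P by (intro Min_le iso_const_finite V) blast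
  also have "\<dots> \<le> c"
  proof (rule Max.boundedI)
    show "finite ((\<lambda>A. real (b A) / real (card A)) ` P)" using finite_elements[OF V P(1)] by simp
    show "(\<lambda>A. real (b A) / real (card A)) ` P \<noteq> {}" using P by auto
    fix x assume "x \<in> (\<lambda>A. real (b A) / real (card A)) ` P"
    then obtain A where A: "A \<in> P" "x = real (b A) / real (card A)" by blast
    then have "finite A" "A \<noteq> {}" using P V by (auto simp: partition_on_def intro: finite_subset)
    then show "x \<le> c" using le[OF A(1)] A(2) by (simp add: divide_le_eq card_gt_0_iff)
  qed
  finally show ?thesis .
qed

text \<open>Split off \<open>n - 1\<close> singletons and keep the rest as one block. This makes the
  range of the outer \<open>Min\<close> non-empty.\<close>

lemma ex_partition_on_card:
  assumes "finite V" "0 < n" "n \<le> card V"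
  shows "\<exists>P. partition_on V P \<and> card P = n"
proof -
  have "n - 1 \<le> card V" using assms by simp
  then obtain S where S: "S \<subseteq> V" "card S = n - 1" "finite S"
    by (rule obtain_subset_with_card_n)
  have "S \<noteq> V" using S assms by auto
  then have "partition_on V (insert (V - S) ((\<lambda>x. {x}) ` S))"
    using S(1) by (auto simp: partition_on_def disjoint_def)
  moreover have "card (insert (V - S) ((\<lambda>x. {x}) ` S)) = n"
    using S assms by (subst card_insert_disjoint) (auto simp: card_image)
  ultimately show ?thesis by blast
qed

lemma iso_const_attained:
  assumes V: "finite V" and n: "0 < n" "n \<le> card V"
  obtains P where "partition_on V P" "card P = n" "0 \<le> iso_const V b n"
    "\<And>A. A \<in> P \<Longrightarrow> real (b A) \<le> iso_const V b n * real (card A)"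
proof -
  have "iso_const V b n \<in> {Max ((\<lambda>A. real (b A) / real (card A)) ` P) | P. partition_on V P \<and> card P = n}"
    unfolding iso_const_def using ex_partition_on_card[OF assms]
    by (intro Min_in iso_const_finite V) blast
  then obtain P where P: "partition_on V P" "card P = n"
    "iso_const V b n = Max ((\<lambda>A. real (b A) / real (card A)) ` P)" by blast
  have finP: "finite P" using finite_elements[OF V P(1)] .
  have ratio: "real (b A) / real (card A) \<le> iso_const V b n" if "A \<in> P" for A
    unfolding P(3) using that finP by (intro Max_ge) auto
  obtain A where "A \<in> P" using P n by fastforce
  then have "0 \<le> iso_const V b n" using ratio[of A] by (meson divide_nonneg_nonneg of_nat_0_le_iff order_trans)
  moreover have "real (b A) \<le> iso_const V b n * real (card A)" if A: "A \<in> P" for A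
  proof -
    have "finite A" "A \<noteq> {}" using A P V by (auto simp: partition_on_def intro: finite_subset)
    then show ?thesis using ratio[OF A] by (simp add: divide_le_eq card_gt_0_iff)
  qed
  ultimately show thesis using that P by blast
qed

section \<open>Refining an optimal partition by a translate of its smallest part\<close>

text \<open>The factor 2 pays for the two boundaries that contribute to \<open>B - C\<close>, the
  factor \<open>n + 1\<close> for the points that \<open>B\<close> loses to \<open>C\<close>. Of the
  boundary only \<open>b_Diff\<close> and \<open>b_image\<close> enter.\<close>

theorem (in transitive_action) iso_const_Suc_le:
  assumes fin: "finite E" and n: "2 \<le> n" "n \<le> card E"
    and no_action: "\<not> has_transitive_action_on_points G n"
    and b_Diff: "\<And>A B. A \<subseteq> E \<Longrightarrow> B \<subseteq> E \<Longrightarrow> b (A - B) \<le> b A + b B"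
    and b_image: "\<And>g A. g \<in> carrier G \<Longrightarrow> A \<subseteq> E \<Longrightarrow> b (\<phi> g ` A) \<le> b A"
  shows "iso_const E b (n + 1) \<le> 2 * (real n + 1) * iso_const E b n"
proof -
  define h where "h = iso_const E b n"
  obtain P where P: "partition_on E P" "card P = n" and h0: "0 \<le> h"
    and h: "\<And>A. A \<in> P \<Longrightarrow> real (b A) \<le> h * real (card A)"
    using iso_const_attained[OF fin _ n(2), of b] n(1) unfolding h_def by (metis zero_less_numeral less_le_trans)
  have sub: "B \<subseteq> E" if "B \<in> P" for B using P that by (auto simp: partition_on_def)
  have finB: "finite B" if "B \<in> P" for B using sub[OF that] fin finite_subset by blast
  have finP: "finite P" using P fin finite_elements by blast
  have P0: "P \<noteq> {}" using P n by auto
  obtain A where A: "A \<in> P" and smallest: "\<And>B. B \<in> P \<Longrightarrow> card A \<le> card B"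
    using arg_min_if_finite(1)[OF finP P0] arg_min_least[OF finP P0] by blast
  obtain g where g: "g \<in> carrier G"
    and far: "\<And>B. B \<in> P \<Longrightarrow> (n + 1) * card (B \<inter> \<phi> g ` A) \<le> n * card B"
    using has_transitive_action_of_almost_invariant_partition[OF fin n(1) P A smallest] no_action
    by (metis not_le)
  define C where "C = \<phi> g ` A"
  have CE: "C \<subseteq> E" using sub[OF A] surj_prop[OF g] by (auto simp: C_def)
  have cardC: "card C = card A"
    using card_image_Int[OF g sub[OF A] sub[OF A]] by (simp add: C_def)
  have pos: "0 < card B" if "B \<in> P" for B
    using that P finB by (auto simp: partition_on_def card_gt_0_iff)
  \<comment> \<open>Every part keeps at least \<open>1/(n+1)\<close> of its points. In particular
    none is swallowed by \<open>C\<close>, so \<open>Q\<close> really has \<open>n + 1\<close>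
    parts.\<close>
  have large: "card B \<le> (n + 1) * card (B - C)" if B: "B \<in> P" for B
  proof -
    have "card B = card (B \<inter> C) + card (B - C)" using finB[OF B] by (metis card_Int_Diff)
    then have "(n + 1) * card B = (n + 1) * card (B \<inter> C) + (n + 1) * card (B - C)"
      by (metis distrib_left)
    then show ?thesis using far[OF B] unfolding C_def by simp
  qed
  have ne: "B - C \<noteq> {}" if "B \<in> P" for B using large[OF that] pos[OF that] by (metis card.empty mult_0_right not_le)
  have C0: "C \<noteq> {}" using pos[OF A] cardC by auto
  define Q where "Q = insert C ((\<lambda>B. B - C) ` P)"
  have disj: "B \<inter> D = {}" if "B \<in> P" "D \<in> P" "B \<noteq> D" for B D
    using P that by (auto simp: partition_on_def disjoint_def)
  have "\<Union>Q = E" using P CE by (auto simp: Q_def partition_on_def)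
  moreover have "disjoint Q"
    unfolding Q_def disjoint_def using disj by (auto; blast)
  moreover have "{} \<notin> Q" using C0 ne by (auto simp: Q_def)
  ultimately have Q: "partition_on E Q" by (simp add: partition_on_def)
  have "inj_on (\<lambda>B. B - C) P"
  proof (intro inj_onI, rule ccontr)
    fix B D assume BD: "B \<in> P" "D \<in> P" "B - C = D - C" "B \<noteq> D"
    then have "B - C \<subseteq> B \<inter> D" by blast
    with disj[OF BD(1,2,4)] ne[OF BD(1)] show False by blast
  qed
  moreover have "C \<notin> (\<lambda>B. B - C) ` P" using C0 by blast
  ultimately have cardQ: "card Q = n + 1" using finP P by (simp add: Q_def card_image)
  have bC: "real (b C) \<le> h * real (card A)"
    using b_image[OF g sub[OF A]] h[OF A] unfolding C_def by linarith
  have "real (b D) \<le> 2 * (real n + 1) * h * real (card D)" if D: "D \<in> Q" for D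
  proof (cases "D = C")
    case True
    have "h * real (card A) \<le> 2 * (real n + 1) * (h * real (card A))"
      using h0 mult_right_mono[of 1 "2 * (real n + 1)" "h * real (card A)"] by simp
    then show ?thesis using bC True cardC by (simp add: mult.assoc)
  next
    case False
    then obtain B where B: "B \<in> P" "D = B - C" using D by (auto simp: Q_def)
    have "real (b D) \<le> real (b B) + real (b C)" using b_Diff[OF sub[OF B(1)] CE] B(2) by (simp flip: of_nat_add)
    also have "\<dots> \<le> h * real (card B) + h * real (card A)" using h[OF B(1)] bC by simp
    \<comment> \<open>This is where the choice of a smallest part pays off: the boundary of its
      translate is charged to any \<open>B\<close>.\<close>
    also have "\<dots> \<le> h * real (card B) + h * real (card B)"
      using smallest[OF B(1)] h0 by (simp add: mult_left_mono)
    also have "\<dots> = 2 * h * real (card B)" by simp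
    also have "\<dots> \<le> 2 * h * real ((n + 1) * card D)"
      using large[OF B(1)] h0 unfolding B(2) by (intro mult_left_mono of_nat_mono) simp_all
    finally show ?thesis by (simp add: algebra_simps)
  qed
  from iso_const_le[OF fin Q cardQ _ this] show ?thesis by (simp add: h_def)
qed

section \<open>Edge and vertex boundaries under differences and automorphisms\<close>

context finite_regular_graph
begin

lemma finite_edges: "finite E"
  using edges finite_vertices by (intro finite_subset[of E "Pow V"]) auto

lemma edgeE:
  assumes "e \<in> E"
  obtains u v where "e = {u, v}" "u \<noteq> v" "u \<in> V" "v \<in> V"
  using assms edges by (auto simp: card_2_iff)

text \<open>An edge whose ends agree on membership in \<open>A\<close> and in \<open>B\<close> also
  agrees on \<open>A - B\<close>, so an edge cut by the difference is cut by \<open>A\<close> or by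
  \<open>B\<close>.\<close>

lemma card_edge_boundary_Diff:
  "card (edge_boundary E (A - B)) \<le> card (edge_boundary E A) + card (edge_boundary E B)"
proof -
  have "edge_boundary E (A - B) \<subseteq> edge_boundary E A \<union> edge_boundary E B"
  proof
    fix e assume e: "e \<in> edge_boundary E (A - B)"
    then obtain u v where uv: "e = {u, v}" "u \<noteq> v" by (auto simp: edge_boundary_def elim: edgeE)
    have "card ({u, v} \<inter> X) = (if u \<in> X then 1 else 0) + (if v \<in> X then 1 else 0)" for X
      using uv(2) by (auto simp: Int_insert_left)
    then show "e \<in> edge_boundary E A \<union> edge_boundary E B"
      using e uv(1) by (auto simp: edge_boundary_def split: if_splits)
  qed
  from card_mono[OF _ this] show ?thesis
    using card_Un_le[of "edge_boundary E A" "edge_boundary E B"] finite_edges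
    by (force simp: edge_boundary_def)
qed

lemma card_edge_boundary_image:
  assumes f: "graph_automorphism V E f" and A: "A \<subseteq> V"
  shows "card (edge_boundary E (f ` A)) \<le> card (edge_boundary E A)"
proof (rule surj_card_le)
  show "finite (edge_boundary E A)" using finite_edges by (simp add: edge_boundary_def)
  have bij: "bij_betw f V V" and E_iff: "\<And>u v. u \<in> V \<Longrightarrow> v \<in> V \<Longrightarrow> {f u, f v} \<in> E \<longleftrightarrow> {u, v} \<in> E"
    using f by (auto simp: graph_automorphism_def)
  show "edge_boundary E (f ` A) \<subseteq> (`) f ` edge_boundary E A"
  proof
    fix e assume "e \<in> edge_boundary E (f ` A)"
    then have e: "e \<in> E" "card (e \<inter> f ` A) = 1" by (auto simp: edge_boundary_def)
    obtain u v where "e = {f u, f v}" and uv: "u \<in> V" "v \<in> V"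
      using edgeE[OF e(1)] bij_betw_imp_surj_on[OF bij] by (metis imageE)
    then have img: "e = f ` {u, v}" by simp
    have inj: "inj_on f V" using bij by (rule bij_betw_imp_inj_on)
    have "e \<inter> f ` A = f ` ({u, v} \<inter> A)"
      unfolding img using uv A by (simp add: inj_on_image_Int[OF inj])
    moreover have "inj_on f ({u, v} \<inter> A)" using inj A by (meson inj_on_subset le_infI2)
    ultimately have "card ({u, v} \<inter> A) = 1" using e(2) by (simp add: card_image)
    moreover have "{u, v} \<in> E" using e(1) img E_iff uv by simp
    ultimately have "{u, v} \<in> edge_boundary E A" by (simp add: edge_boundary_def)
    then show "e \<in> (`) f ` edge_boundary E A" unfolding img by (rule imageI)
  qed
qed

text \<open>An edge leaving \<open>A - B\<close> crosses \<open>A\<close> or \<open>B\<close>, and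
  both of its ends then lie in that vertex boundary.\<close>

lemma card_vertex_boundary_Diff:
  "card (vertex_boundary V E (A - B)) \<le> card (vertex_boundary V E A) + card (vertex_boundary V E B)"
  if "A \<subseteq> V" "B \<subseteq> V"
proof -
  have "vertex_boundary V E (A - B) \<subseteq> vertex_boundary V E A \<union> vertex_boundary V E B"
    using that unfolding vertex_boundary_def by blast
  moreover have "finite (vertex_boundary V E A \<union> vertex_boundary V E B)"
    using that by (auto intro!: finite_subset[OF _ finite_vertices] simp: vertex_boundary_def)
  ultimately show ?thesis
    using card_mono card_Un_le order_trans by metis
qed

lemma card_vertex_boundary_image:
  assumes f: "graph_automorphism V E f" and A: "A \<subseteq> V"
  shows "card (vertex_boundary V E (f ` A)) \<le> card (vertex_boundary V E A)"
proof (rule surj_card_le)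
  show "finite (vertex_boundary V E A)"
    using A by (auto intro!: finite_subset[OF _ finite_vertices] simp: vertex_boundary_def)
  have surj: "f ` V = V" and inj: "inj_on f V"
    and E_iff: "\<And>u v. u \<in> V \<Longrightarrow> v \<in> V \<Longrightarrow> {f u, f v} \<in> E \<longleftrightarrow> {u, v} \<in> E"
    using f by (auto simp: graph_automorphism_def bij_betw_def)
  have mem: "f x \<in> f ` A \<longleftrightarrow> x \<in> A" if "x \<in> V" for x
    using inj A that by (simp add: inj_on_image_mem_iff)
  show "vertex_boundary V E (f ` A) \<subseteq> f ` vertex_boundary V E A"
  proof
    fix y assume y: "y \<in> vertex_boundary V E (f ` A)"
    have fA: "f ` A \<subseteq> V" using A surj by blast
    \<comment> \<open>The inner and outer halves of the boundary merge into one condition: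
      \<open>y\<close> has a neighbour on the other side of the set. Automorphisms preserve
      this.\<close>
    obtain w where w: "w \<in> V" "y \<in> V" "{y, w} \<in> E" "y \<in> f ` A \<longleftrightarrow> w \<notin> f ` A"
      using y fA by (auto simp: vertex_boundary_def)
    obtain x z where xz: "y = f x" "w = f z" "x \<in> V" "z \<in> V" using w surj by blast
    then have "{x, z} \<in> E" "x \<in> A \<longleftrightarrow> z \<notin> A" using w E_iff mem by auto
    then have "x \<in> vertex_boundary V E A" using xz by (auto simp: vertex_boundary_def)
    then show "y \<in> f ` vertex_boundary V E A" using xz by blast
  qed
qed

end

theorem theorem1p7:
  fixes V :: "'v set" and E :: "'v set set" and n :: nat
    and G :: "('g, 'm) monoid_scheme" and \<phi> :: "'g \<Rightarrow> 'v \<Rightarrow> 'v"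
  assumes "finite_regular_graph V E"
    and "vertex_transitive V E"
    and "2 \<le> n" and "n \<le> card V - 1"
    and "transitive_action G V \<phi>"
    and "\<forall>g\<in>carrier G. graph_automorphism V E (\<phi> g)"
    and "\<not> has_transitive_action_on_points G n"
  shows "h_const V E (n + 1) \<le> 2 * (real n + 1) * h_const V E n \<and>
         iota_const V E (n + 1) \<le> 2 * (real n + 1) * iota_const V E n"
proof -
  interpret graph: finite_regular_graph V E by fact
  interpret action: transitive_action G V \<phi> by fact
  have n: "n \<le> card V" using assms(4) by simp
  have "h_const V E k = iso_const V (\<lambda>A. card (edge_boundary E A)) k" for k
    by (simp add: h_const_def iso_const_def)
  moreover have "iota_const V E k = iso_const V (\<lambda>A. card (vertex_boundary V E A)) k" for k
    by (simp add: iota_const_def iso_const_def)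
  moreover have aut: "graph_automorphism V E (\<phi> g)" if "g \<in> carrier G" for g
    using assms(6) that by blast
  have "iso_const V (\<lambda>A. card (edge_boundary E A)) (n + 1)
          \<le> 2 * (real n + 1) * iso_const V (\<lambda>A. card (edge_boundary E A)) n"
    by (rule action.iso_const_Suc_le[OF graph.finite_vertices assms(3) n assms(7)
          graph.card_edge_boundary_Diff graph.card_edge_boundary_image[OF aut]])
  moreover have "iso_const V (\<lambda>A. card (vertex_boundary V E A)) (n + 1)
          \<le> 2 * (real n + 1) * iso_const V (\<lambda>A. card (vertex_boundary V E A)) n"
    by (rule action.iso_const_Suc_le[OF graph.finite_vertices assms(3) n assms(7)
          graph.card_vertex_boundary_Diff graph.card_vertex_boundary_image[OF aut]])
  ultimately show ?thesis by simp
qed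

end
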